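(* Let $X$ be an Archimedean fordable pre-Riesz space with the Riesz decomposition property and let $(Y,i)$ be a vector lattice cover of $X$. Let $\hat B$ be a band in $Y$ such that $Y=\hat B\oplus\hat B^{\mathrm{d}}$, and let $B:=\{x\in X: i(x)\in\hat B\}$. Moreover, let $i(B)$ be majorizing in $\hat B$ and let $i(B^{\mathrm{d}})$ be majorizing in $\hat B^{\mathrm{d}}$. Then $X=B\oplus B^{\mathrm{d}}$.
   Context: All vector spaces are real. An ordered vector space $X$ is a real vector space with a cone $X_+$ (closed under addition and multiplication by nonnegative scalars, $X_+\cap(-X_+)=\{0\}$), ordered by $x\le y$ iff $y-x\in X_+$. It is Archimedean if $nx\le y$ for all $n\in\mathbb N$ implies $x\le 0$. It has the Riesz decomposition property if for all $x_1,x_2,z\in X_+$ with $z\le x_1+x_2$ there are $z_1,z_2\in X_+$ with $z=z_1+z_2$, $z_1\le x_1$, $z_2\le x_2$. A linear subspace $D$ of an ordered vector space $Y$ is order dense in $Y$ if $y=\inf\{z\in D: y\le z\}$ for every $y\in Y$, and $D$ is majorizing in $Y$ if for every $y\in Y$ there is $d\in D$ with $y\le d$. An ordered vector space $X$ is a pre-Riesz space if there exist a vector lattice $Y$ and a bipositive linear map $i\colon X\to Y$ (i.e. $i(x)\ge 0$ iff $x\ge 0$) such that $i(X)$ is order dense in $Y$; then $(Y,i)$ is called a vector lattice cover of $X$. For $M\subseteq X$, $M^u$ is the set of upper bounds of $M$ in $X$. Elements $x,y\in X$ are disjoint, $x\perp y$, if $\{x+y,-x-y\}^u=\{x-y,-x+y\}^u$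 (in a vector lattice this is the usual disjointness). The disjoint complement of $M\subseteq X$ is $M^{\mathrm{d}}=\{x\in X: x\perp y\text{ for all }y\in M\}$, and $M^{\mathrm{dd}}=(M^{\mathrm{d}})^{\mathrm{d}}$. A linear subspace $B$ is a band if $B^{\mathrm{dd}}=B$. In the claim, $B^{\mathrm{d}}$ is taken in $X$ and $\hat B^{\mathrm{d}}$ in $Y$. A pre-Riesz space $X$ is fordable if for some (equivalently, every) vector lattice cover $(Y,i)$ of $X$, for every $y\in Y$ there is a set $S\subseteq X$ with $\{y\}^{\mathrm{d}}=i(S)^{\mathrm{d}}$ in $Y$. *)

theory Defs
  imports Complex_Main "HOL-Library.Lub_Glb" "HOL-Library.Set_Algebras"
begin

text \<open>
  An ordered vector space is a type of class \<^class>\<open>ordered_real_vector\<close>; a vector lattice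
  is a type of sort \<open>{ordered_real_vector, lattice}\<close>.
\<close>

definition archimedean_ordered :: "'a::ordered_real_vector itself \<Rightarrow> bool"
  where "archimedean_ordered _ \<longleftrightarrow>
    (\<forall>x y :: 'a. (\<forall>n::nat. real n *\<^sub>R x \<le> y) \<longrightarrow> x \<le> 0)"

definition riesz_decomposition :: "'a::ordered_real_vector itself \<Rightarrow> bool"
  where "riesz_decomposition _ \<longleftrightarrow>
    (\<forall>x1 x2 z :: 'a. 0 \<le> x1 \<longrightarrow> 0 \<le> x2 \<longrightarrow> 0 \<le> z \<longrightarrow> z \<le> x1 + x2 \<longrightarrow>
      (\<exists>z1 z2. 0 \<le> z1 \<and> 0 \<le> z2 \<and> z = z1 + z2 \<and> z1 \<le> x1 \<and> z2 \<le> x2))"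

definition bipositive :: "('a::ordered_real_vector \<Rightarrow> 'b::ordered_real_vector) \<Rightarrow> bool"
  where "bipositive i \<longleftrightarrow> (\<forall>x. 0 \<le> i x \<longleftrightarrow> 0 \<le> x)"

definition order_dense :: "'b::ordered_real_vector set \<Rightarrow> bool"
  where "order_dense D \<longleftrightarrow> subspace D \<and> (\<forall>y. isGlb UNIV {z \<in> D. y \<le> z} y)"

text \<open>
  The ambient space \<open>W\<close> is allowed to be a subspace of the type. That \<open>D\<close> is a linear subspace
  of \<open>W\<close> is deliberately not part of the definition, so that assuming \<open>majorizing_in D W\<close>
  does not assume \<open>D \<subseteq> W\<close>.
\<close>
definition majorizing_in :: "'b::ordered_real_vector set \<Rightarrow> 'b set \<Rightarrow> bool"
  where "majorizing_in D W \<longleftrightarrow> (\<forall>y\<in>W. \<exists>d\<in>D. y \<le> d)"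

text \<open>
  An ordered vector space \<open>'a\<close> is a pre-Riesz space iff it has some vector lattice cover
  \<open>i :: 'a \<Rightarrow> 'b\<close>.
\<close>
definition vector_lattice_cover ::
    "('a::ordered_real_vector \<Rightarrow> 'b::{ordered_real_vector, lattice}) \<Rightarrow> bool"
  where "vector_lattice_cover i \<longleftrightarrow> linear i \<and> bipositive i \<and> order_dense (range i)"

definition disjoint_elements :: "'a::ordered_real_vector \<Rightarrow> 'a \<Rightarrow> bool"
  where "disjoint_elements x y \<longleftrightarrow>
    ubs UNIV {x + y, - x - y} = ubs UNIV {x - y, - x + y}"

definition disjoint_complement :: "'a::ordered_real_vector set \<Rightarrow> 'a set"
  where "disjoint_complement M = {x. \<forall>y\<in>M. disjoint_elements x y}"

definition band :: "'a::ordered_real_vector set \<Rightarrow> bool"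
  where "band B \<longleftrightarrow> subspace B \<and> disjoint_complement (disjoint_complement B) = B"

text \<open>The whole space is the internal direct sum of the subspaces \<open>U\<close> and \<open>V\<close>.\<close>
definition whole_direct_sum :: "'a::real_vector set \<Rightarrow> 'a set \<Rightarrow> bool"
  where "whole_direct_sum U V \<longleftrightarrow>
    subspace U \<and> subspace V \<and> U \<inter> V = {0} \<and> U + V = UNIV"

text \<open>
  HOL cannot quantify over the type of the cover inside a definition, so the cover witnessing
  that \<open>'a\<close> is fordable is a parameter: \<open>'a\<close> is fordable iff \<open>fordable_via j\<close> holds for some
  \<open>j\<close> (with an arbitrary codomain type).
\<close>
definition fordable_via ::
    "('a::ordered_real_vector \<Rightarrow> 'c::{ordered_real_vector, lattice}) \<Rightarrow> bool"
  where "fordable_via j \<longleftrightarrow> vector_lattice_cover j \<and>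
    (\<forall>y. \<exists>S. disjoint_complement {y} = disjoint_complement (j ` S))"

end

theory Submission
  imports Defs "HOL-Library.Lattice_Algebras"
begin

text \<open>
  Pull the decomposition of \<open>Y\<close> back to \<open>X\<close> with the Riesz decomposition property. For
  \<open>0 \<le> x\<close> in \<open>X\<close> write \<open>i x = u + v\<close> with \<open>u\<close> in the band and \<open>v\<close> in its disjoint complement.
  Disjointness forces \<open>u\<close> and \<open>v\<close> to be positive, and majorization gives \<open>b \<in> B\<close> and
  \<open>c \<in> B\<^sup>d\<close> with \<open>u \<le> i b\<close> and \<open>v \<le> i c\<close>, whence \<open>x \<le> b + c\<close>. The Riesz decomposition
  property splits \<open>x = z1 + z2\<close> with \<open>0 \<le> z1 \<le> b\<close> and \<open>0 \<le> z2 \<le> c\<close>, and since disjoint complements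
  in \<open>Y\<close> are solid, \<open>z1 \<in> B\<close> and \<open>z2 \<in> B\<^sup>d\<close>. Every element of \<open>X\<close> is a difference of positive
  ones because an order dense subspace is majorizing.

  Two facts support this. By order density, elements of \<open>X\<close> are disjoint iff their
  images in \<open>Y\<close> are (\<open>disjoint_elements_cover_iff\<close>); as \<open>i ` B\<close> majorizes the band, this
  identifies \<open>B\<^sup>d\<close> with the preimage of the disjoint complement of the band. In \<open>Y\<close>,
  disjointness of \<open>x\<close> and \<open>y\<close> means \<open>\<bar>x\<bar> \<sqinter> \<bar>y\<bar> = 0\<close> (\<open>disjoint_elements_iff_inf_modulus\<close>),
  which gives solidity.
\<close>

section \<open>Disjointness in vector lattices\<close>

text \<open>
  The absolute value of a vector lattice. It is a constant of its own because the sort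
  \<open>{ordered_real_vector, lattice}\<close> does not provide an operation \<^const>\<open>abs\<close>.
\<close>
definition modulus :: "'b::{ordered_real_vector, lattice} \<Rightarrow> 'b"
  where "modulus x = sup x (- x)"

interpretation modulus: lattice_ab_group_add_abs
  where abs = modulus and less_eq = "(\<le>)" and less = "(<)" and inf = inf and sup = sup
    and plus = "(+)" and zero = "0 :: 'b::{ordered_real_vector, lattice}"
    and minus = "(-)" and uminus = uminus
  by unfold_locales (simp add: modulus_def)

lemma modulus_of_nonneg:
  fixes x :: "'b::{ordered_real_vector, lattice}"
  assumes "0 \<le> x"
  shows "modulus x = x"
  using assms by (rule modulus.abs_of_nonneg)

text \<open>
  The nontrivial half of \<open>c \<sqinter> (a \<squnion> b) = (c \<sqinter> a) \<squnion> (c \<sqinter> b)\<close>: every lattice-ordered group is a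
  distributive lattice.
\<close>
lemma inf_sup_le:
  fixes a b c z :: "'b::{ordered_real_vector, lattice}"
  assumes a: "inf c a \<le> z" and b: "inf c b \<le> z"
  shows "inf c (sup a b) \<le> z"
proof -
  have le: "t \<le> z + sup a b - inf c (sup a b)" if t: "inf c t \<le> z" "t \<le> sup a b" for t
  proof -
    have "inf c (sup a b) - (sup a b - t) \<le> c"
      using diff_mono[of "inf c (sup a b)" c 0 "sup a b - t"] t(2) by simp
    moreover have "inf c (sup a b) - (sup a b - t) \<le> t"
      using diff_right_mono[of "inf c (sup a b)" "sup a b" "sup a b - t"] by simp
    ultimately have "inf c (sup a b) - (sup a b - t) \<le> z"
      using t(1) order_trans[OF inf_greatest] by blast
    then show ?thesis
      by (simp only: le_diff_eq diff_diff_eq2 diff_le_eq ac_simps)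
  qed
  have "sup a b \<le> z + sup a b - inf c (sup a b)"
    using le[OF a] le[OF b] by (intro sup_least) simp_all
  then show ?thesis
    by (simp only: le_diff_eq add.commute[of "sup a b"] add_le_cancel_right)
qed

lemma mem_ubs_doubleton_iff: "t \<in> ubs UNIV {p, q} \<longleftrightarrow> p \<le> t \<and> q \<le> t"
  by (auto simp: ubs_def isUb_def setle_def)

lemma disjoint_elements_iff_modulus_eq:
  fixes x y :: "'b::{ordered_real_vector, lattice}"
  shows "disjoint_elements x y \<longleftrightarrow> modulus (x + y) = modulus (x - y)"
proof -
  have "ubs UNIV {x + y, - x - y} = {modulus (x + y)..}"
    "ubs UNIV {x - y, - x + y} = {modulus (x - y)..}"
    by (auto simp: mem_ubs_doubleton_iff modulus_def algebra_simps)
  then show ?thesis by (simp add: disjoint_elements_def)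
qed

lemma inf_modulus_eq_0_imp_le:
  fixes x y :: "'b::{ordered_real_vector, lattice}"
  assumes "inf (modulus x) (modulus y) = 0"
  shows "modulus (x + y) \<le> modulus (x - y)"
proof -
  let ?a = "modulus x" and ?b = "modulus y" and ?d = "modulus (x - y)"
  have "?a \<le> ?d + ?b"
    using modulus.abs_triangle_ineq[of "x - y" y] by simp
  moreover have "?b \<le> ?d + ?a"
    using modulus.abs_triangle_ineq[of "y - x" x] by (simp add: modulus.abs_minus_commute)
  ultimately have "sup ?a ?b \<le> ?d + inf ?a ?b"
    by (simp add: modulus.add_inf_distrib_left)
  then have "sup ?a ?b + inf ?a ?b \<le> ?d"
    using assms by simp
  then show ?thesis
    using modulus.abs_triangle_ineq[of x y] modulus.add_eq_inf_sup[of ?a ?b] by simp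
qed

lemma disjoint_elements_iff_inf_modulus:
  fixes x y :: "'b::{ordered_real_vector, lattice}"
  shows "disjoint_elements x y \<longleftrightarrow> inf (modulus x) (modulus y) = 0"
proof
  assume "inf (modulus x) (modulus y) = 0"
  then show "disjoint_elements x y"
    using inf_modulus_eq_0_imp_le[of x y] inf_modulus_eq_0_imp_le[of x "- y"]
    by (simp add: disjoint_elements_iff_modulus_eq)
next
  assume "disjoint_elements x y"
  let ?a = "modulus x" and ?b = "modulus y" and ?m = "modulus (x + y)"
  have m: "modulus (x - y) = ?m"
    using \<open>disjoint_elements x y\<close> by (simp add: disjoint_elements_iff_modulus_eq)
  have halve: "t \<le> ?m" if "t + t \<le> ?m + ?m" for t
  proof -
    have "(1/2) *\<^sub>R (t + t) \<le> (1/2) *\<^sub>R (?m + ?m)"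
      using that by (intro scaleR_left_mono) auto
    then show ?thesis by (simp flip: scaleR_2)
  qed
  have bounds: "x + y \<le> ?m" "- (x + y) \<le> ?m" "x - y \<le> ?m" "y - x \<le> ?m"
    using modulus.abs_ge_self[of "x + y"] modulus.abs_ge_minus_self[of "x + y"]
      modulus.abs_ge_self[of "x - y"] modulus.abs_ge_minus_self[of "x - y"] m by auto
  have "x \<le> ?m" "- x \<le> ?m" "y \<le> ?m" "- y \<le> ?m"
    using add_mono[OF bounds(1,3)] add_mono[OF bounds(2,4)]
      add_mono[OF bounds(1,4)] add_mono[OF bounds(2,3)]
    by (intro halve; simp add: algebra_simps)+
  then have sup_le: "sup ?a ?b \<le> ?m"
    by (simp add: modulus_def)
  let ?e = "sup ?a ?b - inf ?a ?b"
  have e: "s - ?b \<le> ?e" if "s = x \<or> s = - x" for s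
    using that modulus.abs_ge_self[of x] modulus.abs_ge_minus_self[of x]
    by (intro diff_mono) (auto intro: le_supI1)
  have e': "s - ?a \<le> ?e" if "s = y \<or> s = - y" for s
    using that modulus.abs_ge_self[of y] modulus.abs_ge_minus_self[of y]
    by (intro diff_mono) (auto intro: le_supI2)
  have shift: "inf (s + t) (s - t) = s - modulus t" for s t :: 'b
    using modulus.add_inf_distrib_left[of s t "- t"]
    by (simp add: modulus_def modulus.neg_sup_eq_inf diff_conv_add_uminus inf_commute del: add_uminus_conv_diff)
  \<comment> \<open>Both moduli being equal to \<open>?m\<close>, expand their infimum by distributivity; each of the
    four terms is \<open>\<plusminus>x - \<bar>y\<bar>\<close> or \<open>\<plusminus>y - \<bar>x\<bar>\<close>, hence at most \<open>?e\<close>.\<close>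
  have "inf (x + y) (x - y) = x - ?b" "inf (x + y) (- (x - y)) = y - ?a"
    "inf (- (x + y)) (x - y) = - y - ?a" "inf (- (x + y)) (- (x - y)) = - x - ?b"
    using shift[of x y] shift[of y x] shift[of "- y" x] shift[of "- x" y]
    by (simp_all add: add.commute inf_commute minus_diff_commute[of y x])
  then have "inf (x + y) (x - y) \<le> ?e" "inf (x + y) (- (x - y)) \<le> ?e"
    "inf (- (x + y)) (x - y) \<le> ?e" "inf (- (x + y)) (- (x - y)) \<le> ?e"
    by (simp_all only: e e' simp_thms)
  then have "inf (x + y) (modulus (x - y)) \<le> ?e" "inf (- (x + y)) (modulus (x - y)) \<le> ?e"
    unfolding modulus_def[of "x - y"] by (simp_all only: inf_sup_le)
  then have "inf (modulus (x - y)) ?m \<le> ?e"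
    unfolding modulus_def[of "x + y"] by (intro inf_sup_le) (simp_all add: inf_commute)
  then have "sup ?a ?b \<le> ?e"
    using sup_le by (simp only: m inf_idem order_trans)
  then have "inf ?a ?b \<le> 0"
    by (simp only: le_diff_eq add_le_same_cancel1)
  then show "inf ?a ?b = 0"
    by (intro order.antisym) simp_all
qed

lemma disjoint_elements_mono:
  fixes x y z :: "'b::{ordered_real_vector, lattice}"
  assumes "disjoint_elements x y" and "modulus z \<le> modulus x"
  shows "disjoint_elements z y"
proof -
  have "inf (modulus z) (modulus y) \<le> inf (modulus x) (modulus y)"
    using assms(2) by (intro inf_mono) auto
  then show ?thesis
    using assms(1) unfolding disjoint_elements_iff_inf_modulus
    by (intro order.antisym) auto
qed

lemma disjoint_elements_sym:
  fixes x y :: "'b::{ordered_real_vector, lattice}"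
  shows "disjoint_elements x y \<longleftrightarrow> disjoint_elements y x"
  by (simp add: disjoint_elements_iff_inf_modulus inf_commute)

lemma disjoint_complement_solid:
  fixes x z :: "'b::{ordered_real_vector, lattice}"
  assumes "x \<in> disjoint_complement M" and "modulus z \<le> modulus x"
  shows "z \<in> disjoint_complement M"
  using assms disjoint_elements_mono unfolding disjoint_complement_def by blast

lemma nonneg_if_disjoint_sum_nonneg:
  fixes u v :: "'b::{ordered_real_vector, lattice}"
  assumes "disjoint_elements u v" and "0 \<le> u + v"
  shows "0 \<le> u"
proof -
  have "- u \<le> v"
    using add_left_mono[OF assms(2), of "- u"] by simp
  then have "- u \<le> inf (modulus u) (modulus v)"
    using modulus.abs_ge_minus_self[of u] modulus.abs_ge_self[of v] by auto
  also have "\<dots> = 0"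
    using assms(1) by (simp add: disjoint_elements_iff_inf_modulus)
  finally show ?thesis by simp
qed

section \<open>Disjointness and vector lattice covers\<close>

lemma disjoint_elements_self_imp_eq_0:
  fixes x :: "'a::ordered_real_vector"
  assumes "disjoint_elements x x"
  shows "x = 0"
proof -
  have "0 \<in> ubs UNIV {x - x, - x + x}"
    unfolding mem_ubs_doubleton_iff by simp
  then have "0 \<in> ubs UNIV {x + x, - x - x}"
    using assms by (simp add: disjoint_elements_def)
  then have "x + x \<le> 0" "- x - x \<le> 0"
    by (simp_all only: mem_ubs_doubleton_iff)
  moreover have "0 \<le> x + x"
    using add_right_mono[OF \<open>- x - x \<le> 0\<close>, of "x + x"] by simp
  ultimately have "x + x = 0"
    by (intro order.antisym)
  then show ?thesis by (simp flip: scaleR_2)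
qed

lemma vector_lattice_cover_le_iff:
  assumes "vector_lattice_cover i"
  shows "i x \<le> i y \<longleftrightarrow> x \<le> y"
proof -
  have "0 \<le> i (y - x) \<longleftrightarrow> 0 \<le> y - x"
    using assms by (simp add: vector_lattice_cover_def bipositive_def)
  then show ?thesis
    using assms linear_diff[of i y x] by (simp add: vector_lattice_cover_def)
qed

text \<open>Order density, read as: an element is determined by the elements of \<open>X\<close> above it.\<close>
lemma vector_lattice_cover_le_if_bounds:
  assumes "vector_lattice_cover i" and "\<And>z. y \<le> i z \<Longrightarrow> w \<le> i z"
  shows "w \<le> y"
proof -
  have "isGlb UNIV {z \<in> range i. y \<le> z} y"
    using assms(1) by (simp add: vector_lattice_cover_def order_dense_def)
  then have "isLb UNIV {z \<in> range i. y \<le> z} w \<Longrightarrow> w \<le> y"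
    by (auto simp: isGlb_def greatestP_def setle_def)
  then show ?thesis
    using assms(2) by (auto simp: isLb_def setge_def)
qed

lemma vector_lattice_cover_majorizing:
  assumes "vector_lattice_cover i"
  shows "\<exists>x. y \<le> i x"
proof (rule ccontr)
  assume none: "\<nexists>x. y \<le> i x"
  \<comment> \<open>An element without upper bounds in \<open>X\<close> is the infimum of the empty set, hence the
    greatest element; but then it is at most \<open>0\<close>, which is the image of \<open>0\<close>.\<close>
  have "y + y \<le> y"
    by (rule vector_lattice_cover_le_if_bounds[OF assms]) (use none in blast)
  then have "y \<le> i 0"
    using assms linear_0[of i] by (simp add: vector_lattice_cover_def)
  then show False using none by blast
qed

lemma disjoint_elements_cover_iff:
  assumes cover: "vector_lattice_cover i"
  shows "disjoint_elements (i x) (i y) \<longleftrightarrow> disjoint_elements x y"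
proof -
  have linear: "linear i"
    using cover by (simp add: vector_lattice_cover_def)
  have lin: "i (x + y) = i x + i y" "i (x - y) = i x - i y"
    by (simp_all add: linear_add[OF linear] linear_diff[OF linear])
  have neg: "- i (x + y) = i (- x - y)" "- i (x - y) = i (- x + y)"
    using linear_neg[OF linear, of "x + y"] linear_neg[OF linear, of "x - y"] by simp_all
  have ub: "modulus (i x + i y) \<le> i z \<longleftrightarrow> z \<in> ubs UNIV {x + y, - x - y}"
    "modulus (i x - i y) \<le> i z \<longleftrightarrow> z \<in> ubs UNIV {x - y, - x + y}" for z
    unfolding modulus_def lin[symmetric] neg le_sup_iff
      vector_lattice_cover_le_iff[OF cover] mem_ubs_doubleton_iff by (rule refl)+
  show ?thesis
  proof
    assume "disjoint_elements (i x) (i y)"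
    then show "disjoint_elements x y"
      using ub unfolding disjoint_elements_iff_modulus_eq
      by (auto simp: disjoint_elements_def)
  next
    assume "disjoint_elements x y"
    then have eq: "modulus (i x + i y) \<le> i z \<longleftrightarrow> modulus (i x - i y) \<le> i z" for z
      by (simp add: ub disjoint_elements_def)
    show "disjoint_elements (i x) (i y)"
      unfolding disjoint_elements_iff_modulus_eq
      by (intro order.antisym; rule vector_lattice_cover_le_if_bounds[OF cover]; simp only: eq)
  qed
qed

text \<open>
  Only the inclusion from left to right needs majorization: an element of \<open>X\<close> disjoint from
  \<open>B = i -` Bhat\<close> is disjoint from every \<open>w\<close> in the band because \<open>\<bar>w\<bar> \<le> i b\<close> for some \<open>b \<in> B\<close>.
\<close>
lemma disjoint_complement_eq_vimage:
  fixes i :: "'a::ordered_real_vector \<Rightarrow> 'b::{ordered_real_vector, lattice}"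
  assumes cover: "vector_lattice_cover i" and band: "band Bhat"
    and major: "majorizing_in (i ` (i -` Bhat)) Bhat"
  shows "disjoint_complement (i -` Bhat) = i -` disjoint_complement Bhat"
proof
  show "i -` disjoint_complement Bhat \<subseteq> disjoint_complement (i -` Bhat)"
    using disjoint_elements_cover_iff[OF cover] by (auto simp: disjoint_complement_def)
next
  have solid: "modulus w \<in> Bhat" if "w \<in> Bhat" for w
    using that band disjoint_complement_solid[of w "disjoint_complement Bhat" "modulus w"]
    by (simp add: band_def)
  show "disjoint_complement (i -` Bhat) \<subseteq> i -` disjoint_complement Bhat"
  proof
    fix x assume x: "x \<in> disjoint_complement (i -` Bhat)"
    have "disjoint_elements (i x) w" if w: "w \<in> Bhat" for w
    proof -
      obtain b where b: "i b \<in> Bhat" "modulus w \<le> i b"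
        using major solid[OF w] unfolding majorizing_in_def by auto
      have "disjoint_elements (i b) (i x)"
        using x b(1) disjoint_elements_cover_iff[OF cover, of x b]
        by (simp add: disjoint_complement_def disjoint_elements_sym[of "i x"])
      moreover have "modulus w \<le> modulus (i b)"
        using b(2) modulus.abs_ge_self order_trans by blast
      ultimately show ?thesis
        using disjoint_elements_mono disjoint_elements_sym by blast
    qed
    then show "x \<in> i -` disjoint_complement Bhat"
      by (simp add: disjoint_complement_def)
  qed
qed

section \<open>Projection bands and direct sums\<close>

theorem theorem25:
  fixes i :: "'a::ordered_real_vector \<Rightarrow> 'b::{ordered_real_vector, lattice}"
    and j :: "'a \<Rightarrow> 'c::{ordered_real_vector, lattice}"
    and B :: "'a set" and Bhat :: "'b set"
  assumes "archimedean_ordered TYPE('a)"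
    and "fordable_via j"
    and "riesz_decomposition TYPE('a)"
    and "vector_lattice_cover i"
    and "band Bhat"
    and "whole_direct_sum Bhat (disjoint_complement Bhat)"
    and "B = {x. i x \<in> Bhat}"
    and "majorizing_in (i ` B) Bhat"
    and "majorizing_in (i ` disjoint_complement B) (disjoint_complement Bhat)"
  shows "whole_direct_sum B (disjoint_complement B)"
proof -
  note cover = \<open>vector_lattice_cover i\<close>
  have lin: "linear i"
    using cover by (simp add: vector_lattice_cover_def)
  have le_iff: "i x \<le> i y \<longleftrightarrow> x \<le> y" for x y
    using cover by (rule vector_lattice_cover_le_iff)
  let ?C = "disjoint_complement Bhat"
  have B: "B = i -` Bhat"
    using \<open>B = {x. i x \<in> Bhat}\<close> by auto
  have Bd: "disjoint_complement B = i -` ?C"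
    using disjoint_complement_eq_vimage[OF cover \<open>band Bhat\<close>] \<open>majorizing_in (i ` B) Bhat\<close>
    by (simp add: B)
  have sub: "subspace Bhat" "subspace ?C" and sum: "Bhat + ?C = UNIV"
    using \<open>whole_direct_sum Bhat ?C\<close> by (auto simp: whole_direct_sum_def)
  have subB: "subspace B" "subspace (disjoint_complement B)"
    unfolding Bd unfolding B using sub lin by (simp_all add: linear_subspace_vimage)
  have inter: "B \<inter> disjoint_complement B = {0}"
  proof -
    have "x = 0" if "x \<in> B \<inter> disjoint_complement B" for x
      using that by (intro disjoint_elements_self_imp_eq_0) (auto simp: disjoint_complement_def)
    then show ?thesis
      using subspace_0[OF subB(1)] subspace_0[OF subB(2)] by auto
  qed
  have solid: "w \<in> Bhat" if "0 \<le> w" "w \<le> y" "y \<in> Bhat" for w y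
    using that \<open>band Bhat\<close> disjoint_complement_solid[of y ?C w]
      modulus_of_nonneg[of w] modulus_of_nonneg[of y] by (auto simp: band_def)
  have solid': "w \<in> ?C" if "0 \<le> w" "w \<le> y" "y \<in> ?C" for w y
    using that disjoint_complement_solid[of y Bhat w]
      modulus_of_nonneg[of w] modulus_of_nonneg[of y] by auto
  have pos: "x \<in> B + disjoint_complement B" if x: "0 \<le> x" for x
  proof -
    obtain u v where uv: "i x = u + v" "u \<in> Bhat" "v \<in> ?C"
      using sum by (metis UNIV_I set_plus_elim)
    have "0 \<le> u + v"
      using x uv(1) le_iff[of 0 x] by (simp add: linear_0[OF lin])
    moreover have "disjoint_elements v u"
      using uv by (simp add: disjoint_complement_def)
    ultimately have "0 \<le> u" "0 \<le> v"
      using nonneg_if_disjoint_sum_nonneg[of u v] nonneg_if_disjoint_sum_nonneg[of v u]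
      by (simp_all add: disjoint_elements_sym[of u v] add.commute)
    obtain b where b: "b \<in> B" "u \<le> i b"
      using \<open>majorizing_in (i ` B) Bhat\<close> uv(2) by (auto simp: majorizing_in_def)
    obtain c where c: "c \<in> disjoint_complement B" "v \<le> i c"
      using assms(9) uv(3) by (auto simp: majorizing_in_def)
    have "0 \<le> b" "0 \<le> c"
      using order_trans[OF \<open>0 \<le> u\<close> b(2)] order_trans[OF \<open>0 \<le> v\<close> c(2)]
        le_iff[of 0 b] le_iff[of 0 c] by (simp_all add: linear_0[OF lin])
    moreover have "x \<le> b + c"
      using le_iff[of x "b + c"] add_mono[OF b(2) c(2)] uv(1) by (simp add: linear_add[OF lin])
    ultimately obtain z1 z2
      where z: "0 \<le> z1" "0 \<le> z2" "x = z1 + z2" "z1 \<le> b" "z2 \<le> c"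
      using \<open>riesz_decomposition TYPE('a)\<close> x unfolding riesz_decomposition_def by blast
    have "0 \<le> i z1" "i z1 \<le> i b" "0 \<le> i z2" "i z2 \<le> i c"
      using z le_iff le_iff[of 0 z1] le_iff[of 0 z2] by (simp_all add: linear_0[OF lin])
    then have "z1 \<in> B" "z2 \<in> disjoint_complement B"
      using b(1) c(1) solid[of "i z1" "i b"] solid'[of "i z2" "i c"]
      unfolding Bd unfolding B by auto
    then show ?thesis
      using z(3) by (simp add: set_plus_intro)
  qed
  have sum_set_eq: "U + V = {x + y |x y. x \<in> U \<and> y \<in> V}" for U V :: "'a set"
    by (auto simp: set_plus_def)
  have subsum: "subspace (B + disjoint_complement B)"
    using subspace_sums[OF subB] by (simp add: sum_set_eq)
  have "x \<in> B + disjoint_complement B" for x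
  proof -
    obtain p where p: "sup (i x) 0 \<le> i p"
      using vector_lattice_cover_majorizing[OF cover] by blast
    then have "x \<le> p" "0 \<le> p"
      using le_iff[of x p] le_iff[of 0 p] by (simp_all add: linear_0[OF lin])
    then have "p - (p - x) \<in> B + disjoint_complement B"
      using subspace_diff[OF subsum pos[of p] pos[of "p - x"]] by simp
    then show ?thesis by simp
  qed
  then show ?thesis
    using subB inter by (auto simp: whole_direct_sum_def)
qed

end
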